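(* For all integers $n\ge 0$ and $N\ge 1$ and all real $x\neq 0$, $$p_n^{(2N+1)}(x)=\frac{1}{(2N-1)!!}\sum_{i=1}^{N}\sum_{m=0}^{n}a_i(N)\binom{2N+m-i-1}{m}\,x^{-(2N+m-i)}\,p_{n-m+i}(x)\,(n-m+i)_i ,$$ where $p_n$ are the Legendre polynomials, $p_n^{(\alpha)}$ are the higher-order Legendre polynomials, and the coefficients $a_i(N)$ ($1\le i\le N$) are given by $a_1(N)=(2N-3)!!$, $a_N(N)=1$, and, for $2\le i\le N-1$, writing $s_0=0$ and $s_j=l_1+\cdots+l_j$, $$a_i(N)=\sum_{k=1}^{i-1}\;\sum_{l_1=0}^{N-s_0-i-1}\;\sum_{l_2=0}^{N-s_1-i-1}\cdots\sum_{l_{k-1}=0}^{N-s_{k-2}-i-1}\left(\prod_{j=1}^{k-1}\left\langle 2N-2s_{j-1}-i-j-1\right\rangle_{l_j}\right)\prod_{m=0}^{N-s_{k-1}-i-1}\left(2N-2s_{k-1}-2m-i-k-1\right)$$ $$\qquad+\sum_{l_1=0}^{N-s_0-i-1}\;\sum_{l_2=0}^{N-s_1-i-1}\cdots\sum_{l_{i-1}=0}^{N-s_{i-2}-i-1}\left(\prod_{j=1}^{i-1}\left\langle 2N-2s_{j-1}-i-j-1\right\rangle_{l_j}\right)\bigl(2(N-s_{i-1}-i)-1\bigr)!!.$$ (For $k=1$ there are no summation indices and the first product is empty, so that the $k=1$ term is $\prod_{m=0}^{N-i-1}(2N-2m-i-2)$.)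
   Context: The Legendre polynomials $p_n(x)$ are defined by the generating function (power series in $t$) $\frac{1}{\sqrt{1-2xt+t^2}}=\sum_{n=0}^\infty p_n(x)t^n$. The higher-order Legendre polynomials $p_n^{(\alpha)}(x)$ are defined by $\left(\frac{1}{\sqrt{1-2tx+t^2}}\right)^{\alpha}=\sum_{n=0}^\infty p_n^{(\alpha)}(x)t^n$. Falling factorial: $(y)_n=y(y-1)\cdots(y-n+1)$ for $n\ge1$, $(y)_0=1$. Double factorial: $n!!=n(n-2)\cdots 5\cdot3\cdot1$ for odd $n>0$, $n!!=n(n-2)\cdots 6\cdot 4\cdot 2$ for even $n>0$, and $(-1)!!=0!!=1$. For an integer $M$ and an integer $k\ge 0$, $\langle M\rangle_k=M(M-2)(M-4)\cdots(M-2(k-1))$ ($k$ factors decreasing in steps of $2$), with $\langle M\rangle_0=1$. *)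

theory Defs
  imports "HOL-Computational_Algebra.Computational_Algebra" Complex_Main
begin

(* Power series in t, with the real number x as a parameter. *)
definition legendre_gf :: "real \<Rightarrow> real fps" where
  "legendre_gf x = inverse (fps_radical root 2 (1 - fps_const (2 * x) * fps_X + fps_X ^ 2))"

definition legendre :: "nat \<Rightarrow> real \<Rightarrow> real" where
  "legendre n x = fps_nth (legendre_gf x) n"

definition legendre_ho :: "nat \<Rightarrow> nat \<Rightarrow> real \<Rightarrow> real" where
  "legendre_ho \<alpha> n x = fps_nth (legendre_gf x ^ \<alpha>) n"

definition falling_fact :: "'a::comm_ring_1 \<Rightarrow> nat \<Rightarrow> 'a" where
  "falling_fact y n = (\<Prod>k<n. y - of_nat k)"

(* Only the values at arguments at least -1 carry meaning; they include (-1)!! = 0!! = 1. *)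
function double_fact :: "int \<Rightarrow> int" where
  "double_fact k = (if k \<le> 0 then 1 else k * double_fact (k - 2))"
  by auto
termination by (relation "measure nat") auto

declare double_fact.simps [simp del]

definition step2_fact :: "int \<Rightarrow> nat \<Rightarrow> int" where
  "step2_fact M k = (\<Prod>j<k. M - 2 * int j)"

definition psum :: "nat list \<Rightarrow> nat \<Rightarrow> int" where
  "psum l j = int (sum_list (take j l))"

(* The range of the iterated sum over l_1, ..., l_r with 0 <= l_j <= N - s_(j-1) - i - 1.
   List positions start at 0, so l_j is l ! (j - 1), and psum l j is s_j. *)
definition sum_range :: "nat \<Rightarrow> nat \<Rightarrow> nat \<Rightarrow> nat list set" where
  "sum_range N i r =
     {l. length l = r \<and> (\<forall>j\<in>{1..r}. int (l ! (j - 1)) \<le> int N - psum l (j - 1) - int i - 1)}"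

definition step2_prod :: "nat \<Rightarrow> nat \<Rightarrow> nat \<Rightarrow> nat list \<Rightarrow> int" where
  "step2_prod N i r l =
     (\<Prod>j=1..r. step2_fact (2 * int N - 2 * psum l (j - 1) - int i - int j - 1) (l ! (j - 1)))"

definition coeff_a :: "nat \<Rightarrow> nat \<Rightarrow> int" where
  "coeff_a i N =
     (if i = 1 then double_fact (2 * int N - 3)
      else if i = N then 1
      else
        (\<Sum>k=1..i-1. \<Sum>l\<in>sum_range N i (k - 1).
            step2_prod N i (k - 1) l *
            (\<Prod>m\<in>{0..int N - psum l (k - 1) - int i - 1}.
               2 * int N - 2 * psum l (k - 1) - 2 * m - int i - int k - 1))
      + (\<Sum>l\<in>sum_range N i (i - 1).
            step2_prod N i (i - 1) l *
            double_fact (2 * (int N - psum l (i - 1) - int i) - 1)))"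

(* Consistency checks: the series really is a square root of 1 / (1 - 2xt + t^2), and the
   sums over sum_range are finite and unfold one summation variable at a time. *)

lemma legendre_gf_square:
  "legendre_gf x ^ 2 * (1 - fps_const (2 * x) * fps_X + fps_X ^ 2) = 1"
proof -
  let ?P = "1 - fps_const (2 * x) * fps_X + fps_X ^ 2 :: real fps"
  have P0: "fps_nth ?P 0 = 1" by simp
  have r: "root (Suc 1) (fps_nth ?P 0) ^ Suc 1 = fps_nth ?P 0" using P0 by simp
  have "fps_radical root (Suc 1) ?P ^ Suc 1 = ?P"
    using power_radical[of ?P root 1] r P0 by simp
  then have sq: "fps_radical root 2 ?P ^ 2 = ?P" by (simp add: numeral_2_eq_2)
  have "fps_nth (fps_radical root 2 ?P) 0 \<noteq> 0" using P0 by (simp add: fps_radical_def numeral_2_eq_2)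
  then have "inverse (fps_radical root 2 ?P) * fps_radical root 2 ?P = 1"
    by (rule inverse_mult_eq_1)
  then have "(inverse (fps_radical root 2 ?P) * fps_radical root 2 ?P) ^ 2 = 1" by simp
  then show ?thesis unfolding legendre_gf_def power_mult_distrib sq .
qed

lemma legendre_gf_nth_0: "fps_nth (legendre_gf x) 0 = 1"
  by (simp add: legendre_gf_def fps_radical_def numeral_2_eq_2)

lemma psum_append: "j \<le> length l \<Longrightarrow> psum (l @ l') j = psum l j"
  by (simp add: psum_def)

lemma sum_range_0: "sum_range N i 0 = {[]}"
  by (auto simp: sum_range_def)

lemma sum_range_Suc:
  "sum_range N i (Suc r) =
     (\<lambda>(l, v). l @ [v]) ` (SIGMA l:sum_range N i r. {v. int v \<le> int N - psum l r - int i - 1})"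
  (is "?A = ?B")
proof
  show "?A \<subseteq> ?B"
  proof
    fix l assume l: "l \<in> ?A"
    then have len: "length l = Suc r"
      and b: "\<And>j. j \<in> {1..Suc r} \<Longrightarrow> int (l ! (j - 1)) \<le> int N - psum l (j - 1) - int i - 1"
      by (auto simp: sum_range_def)
    obtain l' v where lv: "l = l' @ [v]" using len by (cases l rule: rev_cases) auto
    have len': "length l' = r" using len lv by simp
    have "int (l' ! (j - 1)) \<le> int N - psum l' (j - 1) - int i - 1" if "j \<in> {1..r}" for j
    proof -
      have "psum (l' @ [v]) (j - 1) = psum l' (j - 1)"
        using that len' by (intro psum_append) auto
      moreover have "(l' @ [v]) ! (j - 1) = l' ! (j - 1)"
        using that len' by (auto simp: nth_append)
      ultimately show ?thesis using b[of j] that by (simp add: lv)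
    qed
    moreover have "int v \<le> int N - psum l' r - int i - 1"
      using b[of "Suc r"] len' by (simp add: lv nth_append psum_append)
    ultimately show "l \<in> ?B" using len' lv by (force simp: sum_range_def)
  qed
  show "?B \<subseteq> ?A"
  proof
    fix l assume "l \<in> ?B"
    then obtain l' v where lv: "l = l' @ [v]" and l': "l' \<in> sum_range N i r"
      and v: "int v \<le> int N - psum l' r - int i - 1" by auto
    from l' have len': "length l' = r" by (simp add: sum_range_def)
    have "int (l ! (j - 1)) \<le> int N - psum l (j - 1) - int i - 1" if j: "j \<in> {1..Suc r}" for j
    proof (cases "j = Suc r")
      case True
      then show ?thesis using v len' by (simp add: lv nth_append psum_append)
    next
      case False
      have "psum (l' @ [v]) (j - 1) = psum l' (j - 1)"
        using j False len' by (intro psum_append) auto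
      moreover have "(l' @ [v]) ! (j - 1) = l' ! (j - 1)"
        using j False len' by (auto simp: nth_append)
      moreover have "j \<in> {1..r}" using j False by auto
      ultimately show ?thesis using l' by (simp add: lv sum_range_def)
    qed
    then show "l \<in> ?A" using len' lv by (simp add: sum_range_def)
  qed
qed

lemma finite_nat_int_le: "finite {v. int v \<le> c}"
  by (rule finite_subset[of _ "{..nat c}"]) auto

lemma finite_sum_range: "finite (sum_range N i r)"
proof (induction r)
  case 0
  show ?case by (simp add: sum_range_0)
next
  case (Suc r)
  then show ?case
    unfolding sum_range_Suc by (intro finite_imageI finite_SigmaI finite_nat_int_le)
qed

lemma sum_sum_range_Suc:
  "(\<Sum>l\<in>sum_range N i (Suc r). f l) =
     (\<Sum>l\<in>sum_range N i r. \<Sum>v | int v \<le> int N - psum l r - int i - 1. f (l @ [v]))"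
proof -
  let ?X = "SIGMA l:sum_range N i r. {v. int v \<le> int N - psum l r - int i - 1}"
  have inj: "inj_on (\<lambda>(l, v). l @ [v]) ?X"
    by (auto simp: inj_on_def)
  have "(\<Sum>l\<in>sum_range N i (Suc r). f l) = (\<Sum>(l, v)\<in>?X. f (l @ [v]))"
    unfolding sum_range_Suc sum.reindex[OF inj] by (rule sum.cong) auto
  also have "\<dots> = (\<Sum>l\<in>sum_range N i r. \<Sum>v | int v \<le> int N - psum l r - int i - 1. f (l @ [v]))"
    by (rule sum.Sigma[symmetric]) (use finite_sum_range finite_nat_int_le in blast)+
  finally show ?thesis .
qed

end

theory Submission
  imports Defs
begin

text \<open>
  Let \<open>F\<close> be the generating function of the Legendre polynomials and \<open>U = x - t\<close>.
  Differentiating \<open>F\<^sup>2 (1 - 2xt + t\<^sup>2) = 1\<close> gives \<open>F' = U F\<^sup>3\<close>, so each derivative of an odd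
  power of \<open>F\<close> raises the exponent by two. Since \<open>x\<close> is nonzero, \<open>U\<close> has an inverse power
  series \<open>V\<close>, and \<open>V' = V\<^sup>2\<close>. Applying \<open>V d/dt\<close> repeatedly to \<open>F\<close> therefore produces, on the
  one hand, \<open>(2N-1)!! F^(2N+1)\<close> and, on the other hand, a combination of the terms
  \<open>V^(2N-i) F^(i)\<close> with \<open>F^(i)\<close> the \<open>i\<close>-th derivative. The product rule says that the
  coefficient \<open>a(N,i)\<close> of such a term obeys the Pascal-like recurrence

  \<open>a(N+1,i) = (2N-i) a(N,i) + a(N,i-1)\<close>,

  where the first summand comes from differentiating the power of \<open>V\<close> and the second from
  differentiating the derivative of \<open>F\<close>. This is \<open>odd_power_eq_sum_derivs\<close>, and comparing
  coefficients of \<open>t^n\<close> in it, with the negative binomial series for the powers of \<open>V\<close>, yields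
  the formula of the theorem with \<open>a(N,i)\<close> in place of the explicit coefficients.

  It remains to solve the recurrence. Following one column of the triangle upwards to the
  diagonal expresses it through the column to its left
  (\<open>legendre_tri_previous_column\<close>); the number of steps made before changing column is a
  summation variable \<open>l\<^sub>j\<close>, and the factors collected on the way form a product
  with steps of two. Iterating this over the columns, the walk either reaches the diagonal in
  its \<open>k\<close>-th column, which gives the \<open>k\<close>-th group of iterated sums, or arrives in column 1,
  whose entries are double factorials; this gives the last group
  (\<open>legendre_tri_unfold\<close>, \<open>coeff_a_eq_legendre_tri\<close>).
\<close>

section \<open>The triangle of coefficients\<close>

text \<open>
  The recurrence is started at \<open>N = 0\<close>, where the expansion of \<open>F\<close> is \<open>F\<close> itself, with the
  single coefficient 1 in column 0. This makes the case \<open>N = 1\<close> an instance of the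
  recurrence: the factor \<open>2N\<close> kills column 0 from there on.
\<close>

fun legendre_tri :: "nat \<Rightarrow> nat \<Rightarrow> int" where
  "legendre_tri 0 i = (if i = 0 then 1 else 0)"
| "legendre_tri (Suc N) 0 = 2 * int N * legendre_tri N 0"
| "legendre_tri (Suc N) (Suc i) =
     (2 * int N - int (Suc i)) * legendre_tri N (Suc i) + legendre_tri N i"

lemma legendre_tri_above_diagonal: "N < i \<Longrightarrow> legendre_tri N i = 0"
proof (induction N arbitrary: i)
  case (Suc N)
  then show ?case by (cases i) auto
qed auto

lemma legendre_tri_diagonal: "legendre_tri N N = 1"
  by (induction N) (auto simp: legendre_tri_above_diagonal)

lemma legendre_tri_column_0: "N > 0 \<Longrightarrow> legendre_tri N 0 = 0"
proof (induction N)
  case (Suc N)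
  then show ?case by (cases N) auto
qed auto

lemma double_fact_odd_Suc:
  "double_fact (1 + 2 * int N) = (2 * int N + 1) * double_fact (2 * int N - 1)"
  by (subst double_fact.simps) simp

lemma legendre_tri_column_1: "legendre_tri (Suc d) 1 = double_fact (2 * int d - 1)"
proof (induction d)
  case 0
  show ?case by (simp add: double_fact.simps)
next
  case (Suc d)
  have "legendre_tri (Suc (Suc d)) 1 = (2 * int d + 1) * legendre_tri (Suc d) 1"
    using legendre_tri.simps(3)[of "Suc d" 0] legendre_tri_column_0[of "Suc d"]
    by (simp del: legendre_tri.simps)
  then show ?case
    using Suc double_fact_odd_Suc[of d] by simp
qed

lemma step2_fact_0: "step2_fact M 0 = 1"
  by (simp add: step2_fact_def)

lemma step2_fact_Suc: "step2_fact M (Suc k) = M * step2_fact (M - 2) k"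
  by (simp add: step2_fact_def prod.lessThan_Suc_shift algebra_simps del: prod.lessThan_Suc)

text \<open>
  The recurrence applied \<open>d\<close> times down to the diagonal: leaving the column after \<open>l\<close> steps
  gives the \<open>l\<close>-th summand, and never leaving it gives the last term, the diagonal entry being 1.
  The top row \<open>Suc i + d\<close> is written relative to the diagonal so that no subtraction truncates.
\<close>

lemma legendre_tri_previous_column:
  "legendre_tri (Suc i + d) (Suc i) =
     (\<Sum>l<d. step2_fact (2 * int d + int i - 1) l * legendre_tri (i + d - l) i)
     + step2_fact (2 * int d + int i - 1) d"
proof (induction d)
  case 0
  show ?case using legendre_tri_diagonal[of "Suc i"] by (simp add: step2_fact_0)
next
  case (Suc d)
  define M where "M = 2 * int d + int i + 1"
  have "legendre_tri (Suc i + Suc d) (Suc i)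
      = M * legendre_tri (Suc i + d) (Suc i) + legendre_tri (i + Suc d) i"
    by (simp add: M_def algebra_simps)
  also have "\<dots> = legendre_tri (i + Suc d) i
      + (\<Sum>l<d. step2_fact M (Suc l) * legendre_tri (i + Suc d - Suc l) i)
      + step2_fact M (Suc d)"
    unfolding Suc.IH step2_fact_Suc
    by (simp add: M_def algebra_simps sum_distrib_left)
  also have "\<dots> = (\<Sum>l<Suc d. step2_fact M l * legendre_tri (i + Suc d - l) i)
      + step2_fact M (Suc d)"
    unfolding sum.lessThan_Suc_shift by (simp add: step2_fact_0)
  finally show ?case by (simp add: M_def algebra_simps)
qed

section \<open>Unfolding the iterated sums\<close>

lemma length_sum_range: "l \<in> sum_range N i r \<Longrightarrow> length l = r"
  by (simp add: sum_range_def)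

lemma psum_sum_range: "l \<in> sum_range N i r \<Longrightarrow> psum l r = int (sum_list l)"
  by (simp add: psum_def length_sum_range)

text \<open>
  The bound on the last index keeps every partial sum in the same range as the first index, so
  the walk through the triangle is still strictly below the diagonal whenever it changes column.
\<close>

lemma sum_list_sum_range_less:
  "i < N \<Longrightarrow> l \<in> sum_range N i r \<Longrightarrow> sum_list l < N - i"
proof (induction r arbitrary: l)
  case 0
  then show ?case by (simp add: sum_range_0)
next
  case (Suc r)
  from Suc.prems obtain l' v where "l = l' @ [v]" "l' \<in> sum_range N i r"
    and "int v \<le> int N - psum l' r - int i - 1"
    by (auto simp: sum_range_Suc)
  then show ?case by (simp add: psum_sum_range)
qed

lemma step2_prod_snoc:
  assumes "length l = r"
  shows "step2_prod N i (Suc r) (l @ [v]) =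
    step2_prod N i r l * step2_fact (2 * int N - 2 * psum l r - int i - int (Suc r) - 1) v"
proof -
  have "(\<Prod>j=1..r. step2_fact (2 * int N - 2 * psum (l @ [v]) (j - 1) - int i - int j - 1)
          ((l @ [v]) ! (j - 1)))
      = step2_prod N i r l"
    unfolding step2_prod_def
    by (rule prod.cong) (use assms in \<open>auto simp: psum_append nth_append\<close>)
  then show ?thesis
    using assms by (simp add: step2_prod_def psum_append nth_append)
qed

lemma prod_int_range_eq_step2_fact:
  "(\<Prod>m\<in>{0..int d - 1}. M - 2 * m) = step2_fact M d"
  unfolding step2_fact_def
  by (rule prod.reindex_bij_witness[of _ int nat]) auto

text \<open>
  After \<open>r\<close> changes of column, the walks that met the diagonal before are accounted for
  by the sums with \<open>k \<le> r\<close>, and the others are now at row \<open>N - r - s\<^sub>r\<close> and column \<open>i - r\<close>. One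
  more use of \<open>legendre_tri_previous_column\<close> at that place appends the next index to the list.
\<close>

lemma legendre_tri_unfold:
  assumes "i < N" and "r < i"
  shows "legendre_tri N i =
    (\<Sum>k=1..r. \<Sum>l\<in>sum_range N i (k - 1).
       step2_prod N i (k - 1) l *
       (\<Prod>m\<in>{0..int N - psum l (k - 1) - int i - 1}.
          2 * int N - 2 * psum l (k - 1) - 2 * m - int i - int k - 1))
    + (\<Sum>l\<in>sum_range N i r. step2_prod N i r l * legendre_tri (N - r - sum_list l) (i - r))"
  using \<open>r < i\<close>
proof (induction r)
  case 0
  show ?case by (simp add: sum_range_0 step2_prod_def)
next
  case (Suc r)
  have step: "step2_prod N i r l * legendre_tri (N - r - sum_list l) (i - r)
      = step2_prod N i r l *
        (\<Prod>m\<in>{0..int N - psum l r - int i - 1}.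
          2 * int N - 2 * psum l r - 2 * m - int i - int (Suc r) - 1)
      + (\<Sum>v | int v \<le> int N - psum l r - int i - 1.
          step2_prod N i (Suc r) (l @ [v]) *
          legendre_tri (N - Suc r - sum_list (l @ [v])) (i - Suc r))"
    if l: "l \<in> sum_range N i r" for l
  proof -
    define s where "s = sum_list l"
    have s: "s < N - i" and ps: "psum l r = int s"
      using sum_list_sum_range_less[OF assms(1) l] psum_sum_range[OF l] by (auto simp: s_def)
    (* d is the distance to the diagonal, Suc q the current column and M the first factor met. *)
    define d where "d = N - i - s"
    define q where "q = i - Suc r"
    define M where "M = 2 * int d + int q - 1"
    have iq: "i = Suc q + r" and Nd: "N = Suc q + r + d + s"
      using Suc.prems s by (auto simp: q_def d_def)
    have M: "2 * int N - 2 * psum l r - int i - int (Suc r) - 1 = M"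
      unfolding ps M_def by (simp add: iq Nd)
    have R: "{v. int v \<le> int N - psum l r - int i - 1} = {..<d}"
      unfolding ps by (auto simp: iq Nd)
    have P: "(\<Prod>m\<in>{0..int N - psum l r - int i - 1}.
          2 * int N - 2 * psum l r - 2 * m - int i - int (Suc r) - 1) = step2_fact M d"
    proof -
      have "int N - psum l r - int i - 1 = int d - 1"
        unfolding ps by (simp add: iq Nd)
      moreover have "2 * int N - 2 * psum l r - 2 * m - int i - int (Suc r) - 1 = M - 2 * m" for m
        using M by simp
      ultimately show ?thesis by (simp only: prod_int_range_eq_step2_fact)
    qed
    have "legendre_tri (N - r - sum_list l) (i - r) = legendre_tri (Suc q + d) (Suc q)"
      by (simp add: iq Nd s_def[symmetric])
    also have "\<dots> = (\<Sum>v<d. step2_fact M v * legendre_tri (q + d - v) q) + step2_fact M d"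
      unfolding M_def by (rule legendre_tri_previous_column)
    finally have T: "legendre_tri (N - r - sum_list l) (i - r) =
      (\<Sum>v<d. step2_fact M v * legendre_tri (q + d - v) q) + step2_fact M d" .
    have "N - Suc r - sum_list (l @ [v]) = q + d - v" for v
      by (simp add: Nd s_def[symmetric])
    then show ?thesis
      unfolding step2_prod_snoc[OF length_sum_range[OF l]] M R P T q_def[symmetric]
      by (simp add: algebra_simps sum_distrib_left)
  qed
  have "legendre_tri N i =
    (\<Sum>k=1..r. \<Sum>l\<in>sum_range N i (k - 1).
       step2_prod N i (k - 1) l *
       (\<Prod>m\<in>{0..int N - psum l (k - 1) - int i - 1}.
          2 * int N - 2 * psum l (k - 1) - 2 * m - int i - int k - 1))
    + (\<Sum>l\<in>sum_range N i r. step2_prod N i r l * legendre_tri (N - r - sum_list l) (i - r))"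
    using Suc by simp
  also have "(\<Sum>l\<in>sum_range N i r. step2_prod N i r l * legendre_tri (N - r - sum_list l) (i - r))
    = (\<Sum>l\<in>sum_range N i r. step2_prod N i r l *
        (\<Prod>m\<in>{0..int N - psum l r - int i - 1}.
          2 * int N - 2 * psum l r - 2 * m - int i - int (Suc r) - 1))
    + (\<Sum>l\<in>sum_range N i (Suc r).
          step2_prod N i (Suc r) l * legendre_tri (N - Suc r - sum_list l) (i - Suc r))"
    unfolding sum_sum_range_Suc sum.distrib[symmetric] by (rule sum.cong[OF refl step])
  finally show ?case by (simp add: add.assoc)
qed

text \<open>
  With \<open>r = i - 1\<close> all remaining walks have arrived in column 1, where the entries are known.
\<close>

lemma coeff_a_eq_legendre_tri:
  assumes "1 \<le> i" and "i \<le> N"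
  shows "coeff_a i N = legendre_tri N i"
proof (cases "i = 1 \<or> i = N")
  case True
  then show ?thesis
  proof (cases "i = 1")
    case True
    obtain d where "N = Suc d" using assms by (cases N) auto
    then show ?thesis
      using True legendre_tri_column_1[of d] by (simp add: coeff_a_def)
  next
    case False
    then show ?thesis
      using \<open>i = 1 \<or> i = N\<close> by (auto simp: coeff_a_def legendre_tri_diagonal)
  qed
next
  case False
  then have "1 < i" "i < N" using assms by auto
  have "legendre_tri (N - (i - 1) - sum_list l) (i - (i - 1))
      = double_fact (2 * (int N - psum l (i - 1) - int i) - 1)"
    if l: "l \<in> sum_range N i (i - 1)" for l
  proof -
    define d where "d = N - i - sum_list l"
    have "N - (i - 1) - sum_list l = Suc d" "int N - psum l (i - 1) - int i = int d"
      using sum_list_sum_range_less[OF \<open>i < N\<close> l] psum_sum_range[OF l] \<open>1 < i\<close>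
      by (auto simp: d_def)
    then show ?thesis using legendre_tri_column_1[of d] \<open>1 < i\<close> by simp
  qed
  then show ?thesis
    using False legendre_tri_unfold[OF \<open>i < N\<close>, of "i - 1"] \<open>1 < i\<close>
    by (simp add: coeff_a_def)
qed

section \<open>Odd powers of the generating function\<close>

lemma legendre_gf_deriv:
  "fps_deriv (legendre_gf x) = (fps_const x - fps_X) * legendre_gf x ^ 3"
proof -
  define F where "F = legendre_gf x"
  define P where "P = 1 - fps_const (2 * x) * fps_X + fps_X ^ 2"
  define U where "U = fps_const x - fps_X"
  have FP: "F ^ 2 * P = 1"
    unfolding F_def P_def by (rule legendre_gf_square)
  have "fps_const (2 * x) = 2 * fps_const x"
    by (metis fps_const_mult numeral_fps_const)
  then have "fps_deriv P = - 2 * U"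
    by (simp add: P_def U_def power2_eq_square algebra_simps)
  moreover have "fps_deriv (F ^ 2 * P) = 0" by (simp add: FP)
  ultimately have "2 * (F * (fps_deriv F * P - F * U)) = 0"
    by (simp add: power2_eq_square algebra_simps)
  moreover have "F \<noteq> 0" using FP by auto
  ultimately have "fps_deriv F * P = F * U" by simp
  then have "fps_deriv F * (F ^ 2 * P) = U * F ^ 3"
    by (simp add: power2_eq_square power3_eq_cube algebra_simps)
  then show ?thesis
    unfolding FP by (simp add: F_def U_def)
qed

text \<open>
  The operator \<open>f \<mapsto> V f'\<close> sends \<open>F^(2N+1)\<close> to \<open>(2N+1) F^(2N+3)\<close>, because \<open>V\<close> cancels the
  factor \<open>U\<close> of \<open>F'\<close>. Because of \<open>V' = V\<^sup>2\<close>, it sends a term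
  \<open>V^(2N-i) F^(i)\<close> to a combination of the terms with \<open>N + 1\<close> for \<open>N\<close> and with \<open>i\<close> or \<open>i + 1\<close>
  for \<open>i\<close>.
\<close>

lemma odd_power_eq_sum_derivs:
  fixes F U V :: "'a::field_char_0 fps"
  assumes F': "fps_deriv F = U * F ^ 3" and U': "fps_deriv U = - 1" and UV: "U * V = 1"
  shows "of_int (double_fact (2 * int N - 1)) * F ^ (2 * N + 1) =
    (\<Sum>i\<le>N. of_int (legendre_tri N i) * V ^ (2 * N - i) * fps_nth_deriv i F)"
proof (induction N)
  case 0
  show ?case by (simp add: double_fact.simps)
next
  case (Suc N)
  have V': "fps_deriv V = V ^ 2"
  proof -
    have "fps_deriv (U * V) = 0" by (simp add: UV)
    then have "U * fps_deriv V = V" by (simp add: U')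
    then have "(U * V) * fps_deriv V = V * V" by (metis mult.assoc mult.commute)
    then show ?thesis by (simp add: UV power2_eq_square)
  qed
  let ?c = "\<lambda>i. of_int (legendre_tri N i) :: 'a fps"
  let ?D = "\<lambda>i. fps_nth_deriv i F"
  have D: "of_int (double_fact (2 * int (Suc N) - 1))
      = of_int (double_fact (2 * int N - 1)) * (of_nat (2 * N + 1) :: 'a fps)"
    using double_fact_odd_Suc[of N] by simp
  have "fps_deriv (F ^ (2 * N + 1)) = of_nat (2 * N + 1) * F ^ (2 * N) * (U * F ^ 3)"
    by (simp only: fps_deriv_power' F' add_diff_cancel_right' mult_ac)
  then have F_pow': "fps_deriv (F ^ (2 * N + 1)) = of_nat (2 * N + 1) * (U * F ^ (2 * N + 3))"
    by (simp only: power_add mult_ac)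
  have "2 * Suc N + 1 = 2 * N + 3" by simp
  then have "of_int (double_fact (2 * int (Suc N) - 1)) * F ^ (2 * Suc N + 1)
      = (U * V) * (of_int (double_fact (2 * int N - 1)) * of_nat (2 * N + 1) * F ^ (2 * N + 3))"
    by (simp only: D UV mult_1)
  also have "\<dots> = V * (of_int (double_fact (2 * int N - 1)) * fps_deriv (F ^ (2 * N + 1)))"
    unfolding F_pow' by (simp only: mult_ac)
  also have "\<dots> = V * fps_deriv (of_int (double_fact (2 * int N - 1)) * F ^ (2 * N + 1))"
    by simp
  also have "\<dots> = (\<Sum>i\<le>N. V * fps_deriv (?c i * V ^ (2 * N - i) * ?D i))"
    unfolding Suc.IH by (simp add: fps_deriv_sum sum_distrib_left)
  also have "\<dots> = (\<Sum>i\<le>N. of_int (2 * int N - int i) * ?c i * V ^ (2 * Suc N - i) * ?D i)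
      + (\<Sum>i\<le>N. ?c i * V ^ (2 * Suc N - Suc i) * ?D (Suc i))"
    unfolding sum.distrib[symmetric]
  proof (rule sum.cong[OF refl])
    fix i assume i: "i \<in> {..N}"
    (* The exponent 2N - i, named so that the factor in the recurrence is the same number. *)
    define k where "k = 2 * N - i"
    have k: "2 * N = i + k" and ik: "2 * int N - int i = int k"
      using i by (auto simp: k_def)
    have "fps_deriv (V ^ k) = of_nat k * V ^ (k + 1)"
      unfolding fps_deriv_power' V' by (cases k) (simp_all add: power2_eq_square mult_ac)
    then show "V * fps_deriv (?c i * V ^ (2 * N - i) * ?D i)
      = of_int (2 * int N - int i) * ?c i * V ^ (2 * Suc N - i) * ?D i
        + ?c i * V ^ (2 * Suc N - Suc i) * ?D (Suc i)"
      unfolding ik using k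
      by (simp add: fps_nth_deriv_commute algebra_simps del: fps_nth_deriv.simps)
  qed
  (* Both sums get the range of the new row: the first is padded by a zero entry beyond the
     diagonal, the second is shifted by one column. *)
  also have "(\<Sum>i\<le>N. of_int (2 * int N - int i) * ?c i * V ^ (2 * Suc N - i) * ?D i)
    = (\<Sum>i\<le>Suc N. of_int (2 * int N - int i) * ?c i * V ^ (2 * Suc N - i) * ?D i)"
    by (simp add: legendre_tri_above_diagonal)
  also have "\<dots> + (\<Sum>i\<le>N. ?c i * V ^ (2 * Suc N - Suc i) * ?D (Suc i))
    = (\<Sum>i\<le>Suc N. of_int (legendre_tri (Suc N) i) * V ^ (2 * Suc N - i) * ?D i)"
    unfolding sum.atMost_Suc_shift
    by (simp add: sum.distrib[symmetric] algebra_simps del: sum.atMost_Suc fps_nth_deriv.simps)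
  finally show ?case .
qed

section \<open>Comparison of coefficients\<close>

lemma falling_fact_Suc: "falling_fact y (Suc n) = y * falling_fact (y - 1) n"
  by (simp add: falling_fact_def prod.lessThan_Suc_shift algebra_simps del: prod.lessThan_Suc)

lemma fps_nth_nth_deriv:
  fixes f :: "'a::comm_ring_1 fps"
  shows "fps_nth (fps_nth_deriv i f) n = falling_fact (of_nat (n + i)) i * fps_nth f (n + i)"
proof (induction i arbitrary: f)
  case 0
  show ?case by (simp add: falling_fact_def)
next
  case (Suc i)
  then show ?case by (simp add: falling_fact_Suc algebra_simps)
qed

text \<open>
  The negative binomial series, after pulling the constant \<open>c\<close> out of \<open>c - t = c (1 - t/c)\<close>.
\<close>

lemma fps_nth_inverse_linear_power:
  fixes c :: "'a::field_char_0"
  assumes "c \<noteq> 0" and "k > 0"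
  shows "fps_nth (inverse (fps_const c - fps_X) ^ k) m
    = of_nat ((k + m - 1) choose m) * c powi (- int (k + m))"
proof -
  have "fps_const c - fps_X = fps_const c * (1 - fps_const (inverse c) * fps_X)"
    using assms by (simp add: right_diff_distrib mult.assoc[symmetric])
  then have "inverse (fps_const c - fps_X) ^ k
      = fps_const (inverse c ^ k) * inverse ((1 - fps_const (inverse c) * fps_X) ^ k)"
    by (simp only: fps_inverse_mult power_mult_distrib fps_const_inverse fps_inverse_power fps_const_power)
  also have "fps_nth \<dots> m = inverse c ^ k * (of_nat ((k + m - 1) choose m) * inverse c ^ m)"
    using assms by (simp add: one_minus_const_fps_X_neg_power')
  moreover have "c powi (- int (k + m)) = inverse c ^ (k + m)"
    by (simp only: power_int_minus power_int_of_nat power_inverse)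
  ultimately show ?thesis
    by (simp add: power_add mult_ac del: of_nat_add)
qed

theorem theorem2:
  fixes n N :: nat and x :: real
  assumes "N \<ge> 1" and "x \<noteq> 0"
  shows "legendre_ho (2 * N + 1) n x =
    1 / of_int (double_fact (2 * int N - 1)) *
    (\<Sum>i=1..N. \<Sum>m=0..n.
       of_int (coeff_a i N) * of_nat ((2 * N + m - i - 1) choose m) *
       x powi (- (2 * int N + int m - int i)) *
       legendre (n - m + i) x * falling_fact (of_nat (n - m + i)) i)"
proof -
  define F where "F = legendre_gf x"
  define V where "V = inverse (fps_const x - fps_X)"
  have "double_fact (2 * int N - 1) > 0"
  proof (induction N)
    case (Suc N)
    then show ?case using double_fact_odd_Suc[of N] by simp
  qed (simp add: double_fact.simps)
  then have pos: "real_of_int (double_fact (2 * int N - 1)) \<noteq> 0" by simp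
  have UV: "(fps_const x - fps_X) * V = 1"
    unfolding V_def using assms by (intro inverse_mult_eq_1') auto
  have coeff: "fps_nth (of_int (legendre_tri N i) * V ^ (2 * N - i) * fps_nth_deriv i F) n
    = (\<Sum>m=0..n. of_int (coeff_a i N) * of_nat ((2 * N + m - i - 1) choose m) *
       x powi (- (2 * int N + int m - int i)) *
       legendre (n - m + i) x * falling_fact (of_nat (n - m + i)) i)"
    if i: "i \<in> {1..N}" for i
  proof -
    have V: "fps_nth (V ^ (2 * N - i)) m
      = of_nat ((2 * N + m - i - 1) choose m) * x powi (- (2 * int N + int m - int i))" for m
    proof -
      have "2 * N - i + m = 2 * N + m - i" "int (2 * N + m - i) = 2 * int N + int m - int i"
        using i by auto
      then show ?thesis
        using fps_nth_inverse_linear_power[OF assms(2), of "2 * N - i" m] i assms(1)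
        by (simp add: V_def)
    qed
    have a: "coeff_a i N = legendre_tri N i"
      using i by (simp add: coeff_a_eq_legendre_tri)
    have "fps_nth (of_int (legendre_tri N i) * V ^ (2 * N - i) * fps_nth_deriv i F) n
      = of_int (legendre_tri N i) * fps_nth (V ^ (2 * N - i) * fps_nth_deriv i F) n"
      by (simp add: fps_of_int[symmetric] mult.assoc)
    also have "\<dots> = (\<Sum>m=0..n. of_int (legendre_tri N i) *
        (fps_nth (V ^ (2 * N - i)) m * fps_nth (fps_nth_deriv i F) (n - m)))"
      by (simp only: fps_mult_nth sum_distrib_left)
    also have "\<dots> = (\<Sum>m=0..n. of_int (coeff_a i N) * of_nat ((2 * N + m - i - 1) choose m) *
       x powi (- (2 * int N + int m - int i)) *
       legendre (n - m + i) x * falling_fact (of_nat (n - m + i)) i)"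
      unfolding V fps_nth_nth_deriv F_def legendre_def a by (simp only: mult_ac)
    finally show ?thesis .
  qed
  have "of_int (double_fact (2 * int N - 1)) * F ^ (2 * N + 1) =
      (\<Sum>i\<le>N. of_int (legendre_tri N i) * V ^ (2 * N - i) * fps_nth_deriv i F)"
    by (rule odd_power_eq_sum_derivs[OF _ _ UV]) (simp_all add: F_def legendre_gf_deriv)
  also have "\<dots> = (\<Sum>i=1..N. of_int (legendre_tri N i) * V ^ (2 * N - i) * fps_nth_deriv i F)"
    by (rule sum.mono_neutral_right) (use assms(1) in \<open>auto simp: legendre_tri_column_0 not_less_eq_eq\<close>)
  finally have "fps_nth (of_int (double_fact (2 * int N - 1)) * F ^ (2 * N + 1)) n =
      (\<Sum>i=1..N. fps_nth (of_int (legendre_tri N i) * V ^ (2 * N - i) * fps_nth_deriv i F) n)"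
    by (simp only: fps_sum_nth)
  then have "real_of_int (double_fact (2 * int N - 1)) * legendre_ho (2 * N + 1) n x =
      (\<Sum>i=1..N. fps_nth (of_int (legendre_tri N i) * V ^ (2 * N - i) * fps_nth_deriv i F) n)"
    by (simp add: fps_of_int[symmetric] legendre_ho_def F_def)
  moreover have "L = 1 / d * S" if "d * L = S" "d \<noteq> 0" for L d S :: real
    using that by auto
  ultimately have "legendre_ho (2 * N + 1) n x = 1 / of_int (double_fact (2 * int N - 1)) *
      (\<Sum>i=1..N. fps_nth (of_int (legendre_tri N i) * V ^ (2 * N - i) * fps_nth_deriv i F) n)"
    using pos by blast
  also have "(\<Sum>i=1..N. fps_nth (of_int (legendre_tri N i) * V ^ (2 * N - i) * fps_nth_deriv i F) n)
    = (\<Sum>i=1..N. \<Sum>m=0..n.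
       of_int (coeff_a i N) * of_nat ((2 * N + m - i - 1) choose m) *
       x powi (- (2 * int N + int m - int i)) *
       legendre (n - m + i) x * falling_fact (of_nat (n - m + i)) i)"
    by (rule sum.cong[OF refl coeff])
  finally show ?thesis .
qed

end
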